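(* Let $\rho:\mathbb{R}\to\mathbb{R}$ be a non-affine continuous function that is continuously differentiable at some point $c\in\mathbb{R}$ with $\rho'(c)\neq 0$. Let $W\in\mathbb{R}^{N\times N}$ and let $W=\sum_{l=1}^{L}M_l$ be an arbitrary decomposition of $W$ into matrices $M_l\in\mathbb{R}^{N\times N}$. Let $\beta_1,\dots,\beta_L$ be non-zero real scalars with $\sum_{l=1}^L\beta_l=0$, and let $h>0$ be a scaling parameter. Then for any compact set $\mathcal{K}\subset\mathbb{R}^N$ and all $x\in\mathcal{K}$, $$\lim_{h\to 0}\ \sum_{l=1}^{L}\frac{\beta_l}{h\,\rho'(c)}\,\rho\!\left(\frac{h}{\beta_l}M_lx+c\,\mathbf{1}_N\right)=Wx .$$
   Context: $\rho$ is applied entrywise to vectors, and $\mathbf{1}_N\in\mathbb{R}^N$ is the vector of ones. "Continuously differentiable at $c$" means that $\rho$ is differentiable in a neighbourhood of $c$ and $\rho'$ is continuous at $c$. *)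

theory Defs
  imports "HOL-Analysis.Analysis"
begin

definition affine_function :: "(real \<Rightarrow> real) \<Rightarrow> bool" where
  "affine_function f \<longleftrightarrow> (\<exists>a b. \<forall>t. f t = a * t + b)"

text \<open>Unlike \<open>C1_differentiable_on {c}\<close>, differentiability is required on a whole
  neighbourhood of the point.\<close>

definition continuously_differentiable_at :: "(real \<Rightarrow> real) \<Rightarrow> real \<Rightarrow> bool" where
  "continuously_differentiable_at f c \<longleftrightarrow>
     (\<forall>\<^sub>F t in nhds c. f field_differentiable at t) \<and> isCont (deriv f) c"

definition entrywise :: "(real \<Rightarrow> real) \<Rightarrow> real ^ 'n \<Rightarrow> real ^ 'n" where
  "entrywise f v = (\<chi> i. f (v $ i))"

end

theory Submission
  imports Defs
begin

text \<open>Since the weights \<open>\<beta>\<^sub>l\<close> sum to zero, \<open>\<rho> c\<close> may be subtracted from every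
  activation. Each summand then becomes a difference quotient of \<open>\<rho>\<close> at \<open>c\<close> whose limit is
  the corresponding entry of \<open>M\<^sub>l x\<close>.\<close>

text \<open>At \<open>h = 0\<close> the inner argument equals \<open>c\<close>, so by the chain rule
  \<open>f (h / b * y + c)\<close> has derivative \<open>D * (y / b)\<close> in \<open>h\<close>
  there; the constant factor \<open>b / D\<close> turns this into \<open>y\<close>.\<close>

lemma difference_quotient_tendsto:
  fixes f :: "real \<Rightarrow> real"
  assumes "(f has_field_derivative D) (at c)" "D \<noteq> 0" "b \<noteq> 0"
  shows "((\<lambda>h. b / (h * D) * (f (h / b * y + c) - f c)) \<longlongrightarrow> y) (at 0)"
proof -
  have "((\<lambda>h. f (h / b * y + c)) has_field_derivative D * (y / b)) (at 0)"
    by (rule DERIV_chain2[where f = f]) (use assms in \<open>auto intro!: derivative_eq_intros\<close>)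
  then have "((\<lambda>h. (f (h / b * y + c) - f c) / h) \<longlongrightarrow> D * (y / b)) (at 0)"
    by (simp add: has_field_derivative_iff)
  then have "((\<lambda>h. b / D * ((f (h / b * y + c) - f c) / h)) \<longlongrightarrow> b / D * (D * (y / b))) (at 0)"
    by (rule tendsto_mult_left)
  then show ?thesis
    using assms(2,3) by (simp add: mult.commute)
qed

text \<open>Scalar form of the limit, meant for one coordinate at a time: \<open>y l\<close> will be
  a single entry of \<open>M l *v x\<close>.\<close>

lemma weighted_sum_tendsto:
  fixes f :: "real \<Rightarrow> real"
  assumes "(f has_field_derivative D) (at c)" "D \<noteq> 0"
    and "\<And>l. l \<in> A \<Longrightarrow> b l \<noteq> 0" "(\<Sum>l\<in>A. b l) = 0"
  shows "((\<lambda>h. \<Sum>l\<in>A. b l / (h * D) * f (h / b l * y l + c)) \<longlongrightarrow> (\<Sum>l\<in>A. y l)) (at 0)"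
proof -
  \<comment> \<open>Factoring out \<open>f c / (h * D)\<close> leaves the sum of the weights, which
    vanishes; no case distinction on \<open>h = 0\<close> arises.\<close>
  have "(\<Sum>l\<in>A. b l / (h * D) * f c) = 0" for h
    using assms(4) by (simp flip: sum_distrib_right sum_divide_distrib)
  then have "(\<Sum>l\<in>A. b l / (h * D) * f (h / b l * y l + c))
      = (\<Sum>l\<in>A. b l / (h * D) * (f (h / b l * y l + c) - f c))" for h
    by (simp add: right_diff_distrib sum_subtractf)
  moreover have "((\<lambda>h. \<Sum>l\<in>A. b l / (h * D) * (f (h / b l * y l + c) - f c))
      \<longlongrightarrow> (\<Sum>l\<in>A. y l)) (at 0)"
    by (intro tendsto_sum difference_quotient_tendsto assms)
  ultimately show ?thesis
    by simp
qed

theorem theorem3: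
  fixes \<rho> :: "real \<Rightarrow> real" and c :: real
    and W :: "real ^ 'n ^ 'n"
    and L :: nat
    and M :: "nat \<Rightarrow> real ^ 'n ^ 'n"
    and \<beta> :: "nat \<Rightarrow> real"
    and K :: "(real ^ 'n) set"
  assumes "\<not> affine_function \<rho>"
    and "continuous_on UNIV \<rho>"
    and "continuously_differentiable_at \<rho> c"
    and "deriv \<rho> c \<noteq> 0"
    and "W = (\<Sum>l = 1..L. M l)"
    and "\<And>l. l \<in> {1..L} \<Longrightarrow> \<beta> l \<noteq> 0"
    and "(\<Sum>l = 1..L. \<beta> l) = 0"
    and "compact K"
  shows "\<forall>x\<in>K. ((\<lambda>h. \<Sum>l = 1..L. (\<beta> l / (h * deriv \<rho> c)) *\<^sub>R
             entrywise \<rho> ((h / \<beta> l) *\<^sub>R (M l *v x) + c *\<^sub>R 1)) \<longlongrightarrow> W *v x) (at_right 0)"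
proof (intro ballI vec_tendstoI)
  fix x i
  \<comment> \<open>What holds eventually in \<open>nhds c\<close> holds at \<open>c\<close>
    itself.\<close>
  have "(\<rho> has_field_derivative deriv \<rho> c) (at c)"
    using assms(3) eventually_nhds_x_imp_x
    by (auto simp: continuously_differentiable_at_def DERIV_deriv_iff_field_differentiable)
  \<comment> \<open>The two-sided limit at 0 restricts to \<open>at_right 0\<close>.\<close>
  then have "((\<lambda>h. \<Sum>l = 1..L. \<beta> l / (h * deriv \<rho> c) * \<rho> (h / \<beta> l * (M l *v x) $ i + c))
      \<longlongrightarrow> (\<Sum>l = 1..L. (M l *v x) $ i)) (at_right 0)"
    using assms(4,6,7) by (intro tendsto_within_subset[OF weighted_sum_tendsto]) auto
  moreover have "W *v x = (\<Sum>l = 1..L. M l *v x)"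
    unfolding assms(5) by (induction L) (auto simp: matrix_vector_mult_add_rdistrib)
  \<comment> \<open>The vector \<open>1\<close> has every entry equal to 1, so
    \<open>c *\<^sub>R 1\<close> contributes \<open>c\<close> to entry \<open>i\<close>.\<close>
  ultimately show "((\<lambda>h. (\<Sum>l = 1..L. (\<beta> l / (h * deriv \<rho> c)) *\<^sub>R
      entrywise \<rho> ((h / \<beta> l) *\<^sub>R (M l *v x) + c *\<^sub>R 1)) $ i) \<longlongrightarrow> (W *v x) $ i) (at_right 0)"
    by (simp add: entrywise_def)
qed

end
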